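(* Let $1\le p\le n$, $\varepsilon\in(0,1)$, let $f:\mathbb{R}^{n\times p}\to\mathbb{R}$, and let $X_\star\in\mathrm{St}(p,n)$ be a local minimizer of $f$ over $\mathrm{St}(p,n)$. Assume: (A1) $f$ is twice continuously differentiable and $L_0$-Lipschitz in $\mathrm{St}(p,n)^\varepsilon$; the Euclidean gradient $\nabla f$ is $L_1$-Lipschitz continuous in $\mathrm{St}(p,n)^\varepsilon$; and there exist $L_2>0$ and $\delta_0>0$ such that $\|\nabla^2 f(X)-\nabla^2 f(Y)\|\le L_2\|X-Y\|_{\mathrm F}$ for all $X,Y\in B_{\delta_0}(X_\star)$. (A2) $X_\star$ is a nondegenerate local minimizer, i.e. the Riemannian Hessian $\mathrm{Hess} f(X_\star)$ is positive definite on the tangent space $\mathrm{T}_{X_\star}\mathrm{St}(p,n)$. Let $(X_k)$ be generated by the unit-step iteration $$X_{k+1}=X_k+\Lambda(X_k),\qquad \Lambda(X_k)=T(X_k)+N(X_k),$$ where $N(X)=-\tfrac12 X(X^\top X-I_p)$ and $T(X_k)\in \mathrm{T}_{X_k}\mathrm{St}_{X_k^\top X_k}(p,n)$ is the solution $T$ of the linear equation $$\mathcal{A}_{\mathrm T}(X_k)[T]=-\mathrm{grad} f(X_k)-\mathcal{A}_{\mathrm N}(X_k)[N(X_k)].$$ Then there exists $\bar\delta>0$ such that, for all $X_0\in B_{\bar\delta}(X_\star)\cap\mathrm{St}(p,n)^\varepsilon$, the iterates remain in $\mathrm{St}(p,n)^\varepsilon$ and converge to $X_\star$ quadratically.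
   Context: Notation. $\mathrm{St}(p,n)=\{X\in\mathbb{R}^{n\times p}: X^\top X=I_p\}$; $\mathrm{St}(p,n)^\varepsilon=\{X\in\mathbb{R}^{n\times p}:\|X^\top X-I_p\|_{\mathrm F}\le\varepsilon\}$; $B_r(X)$ is the open Frobenius-norm ball of radius $r$ centered at $X$; $\|\cdot\|$ is the operator norm of linear operators on $\mathbb{R}^{n\times p}$ (with the Frobenius norm). $\nabla f$ and $\nabla^2 f$ are the Euclidean gradient and Hessian ($\nabla^2 f(X)[V]$ is the Hessian applied to $V$). $\mathrm{skew}(A)=\tfrac12(A-A^\top)$. $\mathbb{R}^{n\times p}_*$ is the set of $n\times p$ matrices of full column rank. For $X\in\mathbb{R}^{n\times p}_*$, the layered manifold is $\mathrm{St}_{X^\top X}(p,n)=\{Z\in\mathbb{R}^{n\times p}:Z^\top Z=X^\top X\}$, with tangent space at $X$ given by $\mathrm{T}_X\mathrm{St}_{X^\top X}(p,n)=\{\xi\in\mathbb{R}^{n\times p}:\xi^\top X+X^\top\xi=0\}$. The set $\mathbb{R}^{n\times p}_*$ carries the Riemannian metric $g_Y(\xi,\eta)=\mathrm{tr}\big(\xi^\top(I_n-\tfrac12Y(Y^\top Y)^{-1}Y^\top)\eta(Y^\top Y)^{-1}\big)$, and $\mathrm{St}_{X^\top X}(p,n)$ is viewed as a Riemannian submanifold of $(\mathbb{R}^{n\times p}_*,g)$. The normal space at $X$ with respect to $g$ is $\mathrm{N}_X\mathrm{St}_{X^\top X}(p,n)=\{X(X^\top X)^{-1}S: S=S^\top\in\mathbb{R}^{p\times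 p}\}$. $\mathrm{grad} f(X)$ and $\mathrm{Hess} f(X)$ denote the Riemannian gradient and Riemannian Hessian (via the Levi-Civita connection) of the restriction of $f$ to $\mathrm{St}_{X^\top X}(p,n)$; one has $\mathrm{grad} f(X)=2\,\mathrm{skew}(\nabla f(X)X^\top)X$. At $X_\star\in\mathrm{St}(p,n)$ the layered manifold is $\mathrm{St}(p,n)$ itself; positive definiteness is with respect to $g_{X_\star}$. The operators $\mathcal{A}_{\mathrm T}(X)$ (acting on tangent vectors $V\in\mathrm{T}_X\mathrm{St}_{X^\top X}(p,n)$) and $\mathcal{A}_{\mathrm N}(X)$ (acting on normal vectors $V\in\mathrm{N}_X\mathrm{St}_{X^\top X}(p,n)$) are both given by the formula $$V\mapsto 2\,\mathrm{skew}\big(\nabla^2 f(X)[V]X^\top+\nabla f(X)V^\top\big)X,$$ whose values lie in $\mathrm{T}_X\mathrm{St}_{X^\top X}(p,n)$. Quadratic convergence means $X_k\to X_\star$ and there is a constant $C$ with $\|X_{k+1}-X_\star\|_{\mathrm F}\le C\|X_k-X_\star\|_{\mathrm F}^2$ for all $k$. *)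

theory Defs
  imports "HOL-Analysis.Analysis"
begin

text \<open>
  An \<open>n \<times> p\<close> real matrix is an element of \<^typ>\<open>real^'p^'n\<close>. The norm, distance and inner product
  of this type are the Frobenius ones, so \<^term>\<open>ball X r\<close> is the open Frobenius ball.
\<close>

definition skew :: "real^'m^'m \<Rightarrow> real^'m^'m" where
  "skew A = (1/2) *\<^sub>R (A - transpose A)"

definition stiefel :: "(real^'p^'n) set" where
  "stiefel = {X. transpose X ** X = mat 1}"

definition stiefel_nbhd :: "real \<Rightarrow> (real^'p^'n) set" where
  "stiefel_nbhd \<epsilon> = {X. norm (transpose X ** X - mat 1) \<le> \<epsilon>}"

subsection \<open>Euclidean derivatives\<close>

definition egrad :: "('a::euclidean_space \<Rightarrow> real) \<Rightarrow> 'a \<Rightarrow> 'a" where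
  "egrad f x = (THE D. GDERIV f x :> D)"

text \<open>The norm on the type of bounded linear maps is the operator norm.\<close>

definition ehess :: "('a::euclidean_space \<Rightarrow> real) \<Rightarrow> 'a \<Rightarrow> ('a \<Rightarrow>\<^sub>L 'a)" where
  "ehess f x = Blinfun (frechet_derivative (egrad f) (at x))"

text \<open>
  As usual, being twice continuously differentiable in a set that is not open means being so
  on an open neighbourhood of it.
\<close>

definition twice_cont_diff_on :: "'a::euclidean_space set \<Rightarrow> ('a \<Rightarrow> real) \<Rightarrow> bool" where
  "twice_cont_diff_on S f \<longleftrightarrow>
     (\<exists>U. open U \<and> S \<subseteq> U \<and>
          (\<forall>x\<in>U. f differentiable (at x) \<and> egrad f differentiable (at x)) \<and>
          continuous_on U (ehess f))"

definition local_minimizer_over :: "'a::metric_space set \<Rightarrow> ('a \<Rightarrow> real) \<Rightarrow> 'a \<Rightarrow> bool" where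
  "local_minimizer_over S f x \<longleftrightarrow> x \<in> S \<and> (\<exists>r>0. \<forall>y\<in>S \<inter> ball x r. f x \<le> f y)"

subsection \<open>Levi-Civita connection of a metric on an open subset of a Euclidean space\<close>

definition metric_deriv ::
  "('a::euclidean_space \<Rightarrow> 'a \<Rightarrow> 'a \<Rightarrow> real) \<Rightarrow> 'a \<Rightarrow> 'a \<Rightarrow> 'a \<Rightarrow> 'a \<Rightarrow> real" where
  "metric_deriv g Y \<zeta> \<xi> \<eta> = frechet_derivative (\<lambda>Z. g Z \<xi> \<eta>) (at Y) \<zeta>"

text \<open>
  The Christoffel form is given by the Koszul formula for the constant vector fields
  \<open>\<xi>\<close>, \<open>\<eta>\<close>, \<open>\<zeta>\<close>, whose Lie brackets vanish.
\<close>

definition christoffel ::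
  "('a::euclidean_space \<Rightarrow> 'a \<Rightarrow> 'a \<Rightarrow> real) \<Rightarrow> 'a \<Rightarrow> 'a \<Rightarrow> 'a \<Rightarrow> 'a" where
  "christoffel g Y \<xi> \<eta> =
     (THE \<gamma>. \<forall>\<zeta>. 2 * g Y \<gamma> \<zeta> =
        metric_deriv g Y \<xi> \<eta> \<zeta> + metric_deriv g Y \<eta> \<xi> \<zeta> - metric_deriv g Y \<zeta> \<xi> \<eta>)"

definition levi_civita ::
  "('a::euclidean_space \<Rightarrow> 'a \<Rightarrow> 'a \<Rightarrow> real) \<Rightarrow> ('a \<Rightarrow> 'a) \<Rightarrow> 'a \<Rightarrow> 'a \<Rightarrow> 'a" where
  "levi_civita g F Y \<xi> = frechet_derivative F (at Y) \<xi> + christoffel g Y \<xi> (F Y)"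

subsection \<open>Geometry of the layered manifolds\<close>

text \<open>
  For \<open>X\<close> of full column rank, the layered manifold through \<open>X\<close> is
  \<open>{Z. transpose Z ** Z = transpose X ** X}\<close>. The metric and everything derived from it are
  meaningful only at matrices of full column rank.
\<close>

definition layer_metric :: "real^'p^'n \<Rightarrow> real^'p^'n \<Rightarrow> real^'p^'n \<Rightarrow> real" where
  "layer_metric Y \<xi> \<eta> =
     trace (transpose \<xi>
            ** (mat 1 - (1/2) *\<^sub>R (Y ** matrix_inv (transpose Y ** Y) ** transpose Y))
            ** \<eta> ** matrix_inv (transpose Y ** Y))"

definition tangent_layer :: "real^'p^'n \<Rightarrow> (real^'p^'n) set" where
  "tangent_layer X = {\<xi>. transpose \<xi> ** X + transpose X ** \<xi> = 0}"

definition normal_layer :: "real^'p^'n \<Rightarrow> (real^'p^'n) set" where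
  "normal_layer X = {X ** matrix_inv (transpose X ** X) ** S | S. transpose S = S}"

definition tangent_proj :: "real^'p^'n \<Rightarrow> real^'p^'n \<Rightarrow> real^'p^'n" where
  "tangent_proj X V = (THE \<xi>. \<xi> \<in> tangent_layer X \<and> V - \<xi> \<in> normal_layer X)"

text \<open>Riemannian gradient at \<open>X\<close> of the restriction of \<open>f\<close> to the layered manifold through \<open>X\<close>.\<close>

definition rgrad :: "(real^'p^'n \<Rightarrow> real) \<Rightarrow> real^'p^'n \<Rightarrow> real^'p^'n" where
  "rgrad f X =
     (THE G. G \<in> tangent_layer X \<and>
        (\<forall>\<xi>\<in>tangent_layer X. layer_metric X G \<xi> = frechet_derivative f (at X) \<xi>))"

text \<open>
  The Levi-Civita connection of a Riemannian submanifold is the orthogonal projection of the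
  ambient one, applied to any extension of the vector field. Here \<^term>\<open>rgrad f\<close>, taken at each
  matrix with respect to the layer through that matrix, is such an extension.
\<close>

definition rhess :: "(real^'p^'n \<Rightarrow> real) \<Rightarrow> real^'p^'n \<Rightarrow> real^'p^'n \<Rightarrow> real^'p^'n" where
  "rhess f X \<xi> = tangent_proj X (levi_civita layer_metric (rgrad f) X \<xi>)"

definition rhess_pos_def :: "(real^'p^'n \<Rightarrow> real) \<Rightarrow> real^'p^'n \<Rightarrow> bool" where
  "rhess_pos_def f X \<longleftrightarrow>
     (\<forall>\<xi>\<in>tangent_layer X. \<xi> \<noteq> 0 \<longrightarrow> 0 < layer_metric X (rhess f X \<xi>) \<xi>)"

subsection \<open>The iteration\<close>

text \<open>
  The operators \<open>\<A>\<^sub>T(X)\<close> and \<open>\<A>\<^sub>N(X)\<close> are the restrictions of one and the same map to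
  \<^term>\<open>tangent_layer X\<close> and to \<^term>\<open>normal_layer X\<close>.
\<close>

definition A_op :: "(real^'p^'n \<Rightarrow> real) \<Rightarrow> real^'p^'n \<Rightarrow> real^'p^'n \<Rightarrow> real^'p^'n" where
  "A_op f X V =
     (2 *\<^sub>R skew (blinfun_apply (ehess f X) V ** transpose X + egrad f X ** transpose V)) ** X"

definition normal_step :: "real^'p^'n \<Rightarrow> real^'p^'n" where
  "normal_step X = - ((1/2) *\<^sub>R (X ** (transpose X ** X - mat 1)))"

definition is_tangent_step :: "(real^'p^'n \<Rightarrow> real) \<Rightarrow> real^'p^'n \<Rightarrow> real^'p^'n \<Rightarrow> bool" where
  "is_tangent_step f X T \<longleftrightarrow>
     T \<in> tangent_layer X \<and> A_op f X T = - rgrad f X - A_op f X (normal_step X)"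

definition tangent_step :: "(real^'p^'n \<Rightarrow> real) \<Rightarrow> real^'p^'n \<Rightarrow> real^'p^'n" where
  "tangent_step f X = (THE T. is_tangent_step f X T)"

primrec iterate :: "(real^'p^'n \<Rightarrow> real) \<Rightarrow> real^'p^'n \<Rightarrow> nat \<Rightarrow> real^'p^'n" where
  "iterate f X0 0 = X0"
| "iterate f X0 (Suc k) =
     iterate f X0 k + (tangent_step f (iterate f X0 k) + normal_step (iterate f X0 k))"

definition converges_quadratically :: "(nat \<Rightarrow> 'a::real_normed_vector) \<Rightarrow> 'a \<Rightarrow> bool" where
  "converges_quadratically x l \<longleftrightarrow>
     x \<longlonglongrightarrow> l \<and> (\<exists>C. \<forall>k. norm (x (Suc k) - l) \<le> C * (norm (x k - l))\<^sup>2)"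

end

theory Submission
  imports Defs
begin

text \<open>
  Write \<open>G\<close> for the Euclidean gradient of \<open>f\<close> and \<open>W(X) = 2 skew (G(X) X\<^sup>T)\<close>. At every matrix of
  full column rank the Riemannian gradient is \<open>W(X) X\<close> (\<open>rgrad_eq\<close>), and \<open>A_op f X V\<close> is \<open>W'(X)[V] X\<close>
  (\<open>has_derivative_skew_egrad\<close>). So the equation for the tangent step says \<open>(W + W'[T + N]) X = 0\<close>:
  the full step \<open>\<Lambda> = T + N\<close> is a Newton step for \<open>W = 0\<close>, while its normal part makes it, up to
  second order, a Newton step for \<open>X\<^sup>T X = I\<close>.

  Both equations hold at the minimizer \<open>Y\<close>: there \<open>W(Y) = 0\<close>, since \<open>f\<close> is stationary along
  rotations of \<open>Y\<close> (\<open>first_order_condition\<close>). Subtracting the second-order Taylor expansions at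
  \<open>X\<close>, the new error \<open>D = X + \<Lambda> - Y\<close> satisfies the linear system
  \<open>W'(X)[D] X = O(\<parallel>X - Y\<parallel>\<^sup>2)\<close> and \<open>X\<^sup>T D + D\<^sup>T X = O(\<parallel>X - Y\<parallel>\<^sup>2)\<close> (\<open>newton_step_error\<close>).

  The linear map \<open>D \<mapsto> (W'(X)[D] X, X\<^sup>T D + D\<^sup>T X)\<close> is injective at \<open>X = Y\<close>. Indeed the second
  component vanishes exactly on the tangent space, where the first one is the Riemannian Hessian:
  the gradient field vanishes at \<open>Y\<close>, which removes the Christoffel term, and the derivative of the
  field there is tangent, hence fixed by the projection (\<open>rhess_eq_A_op\<close>). So positive definiteness
  of the Hessian gives injectivity. By compactness of the unit
  sphere the map is then bounded below uniformly for all \<open>X\<close> near \<open>Y\<close>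
  (\<open>injective_family_lower_bound\<close>). This yields \<open>\<parallel>D\<parallel> \<le> C \<parallel>X - Y\<parallel>\<^sup>2\<close>, and it also shows that the
  tangent step exists and is unique, because \<open>A_op f X\<close> maps the tangent space injectively into
  itself. Close enough to \<open>Y\<close> the quadratic estimate at least halves the error, so the iterates stay
  there and converge (\<open>quadratic_iteration_converges\<close>).
\<close>

section \<open>Frobenius calculus of matrices\<close>

lemma inner_matrix_eq_trace: "(A :: real^'b^'a) \<bullet> B = trace (transpose A ** B)"
proof -
  have "A \<bullet> B = (\<Sum>i\<in>UNIV. \<Sum>j\<in>UNIV. A$i$j * B$i$j)"
    by (simp add: inner_vec_def)
  also have "\<dots> = (\<Sum>j\<in>UNIV. \<Sum>i\<in>UNIV. A$i$j * B$i$j)"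
    by (rule sum.swap)
  also have "\<dots> = trace (transpose A ** B)"
    by (simp add: trace_def matrix_matrix_mult_def transpose_def)
  finally show ?thesis .
qed

text \<open>
  Each entry of the product is an inner product of a row of \<open>A\<close> and a column of \<open>B\<close>; the
  Cauchy-Schwarz inequality for the entries is summed over all of them.
\<close>
lemma norm_matrix_mult_le: "norm ((A :: real^'b^'a) ** (B :: real^'c^'b)) \<le> norm A * norm B"
proof -
  have sq: "(norm M)\<^sup>2 = (\<Sum>i\<in>UNIV. (norm (M$i))\<^sup>2)" for M :: "real^'x^'y"
    by (simp add: norm_vec_def[of M] L2_set_def sum_nonneg)
  have entry: "(A ** B)$i$j = A$i \<bullet> transpose B$j" for i j
    by (simp add: matrix_matrix_mult_def inner_vec_def transpose_def)
  have tr: "norm (transpose B) = norm B"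
    by (metis inner_matrix_eq_trace norm_eq_sqrt_inner trace_mul_sym transpose_transpose)
  have "(norm (A ** B))\<^sup>2 = (\<Sum>i\<in>UNIV. \<Sum>j\<in>UNIV. (A$i \<bullet> transpose B$j)\<^sup>2)"
    by (simp add: sq norm_vec_def[of "(A ** B)$_"] L2_set_def sum_nonneg entry)
  also have "\<dots> \<le> (\<Sum>i\<in>UNIV. \<Sum>j\<in>UNIV. (norm (A$i))\<^sup>2 * (norm (transpose B$j))\<^sup>2)"
  proof (intro sum_mono)
    fix i j
    show "(A$i \<bullet> transpose B$j)\<^sup>2 \<le> (norm (A$i))\<^sup>2 * (norm (transpose B$j))\<^sup>2"
      using Cauchy_Schwarz_ineq[of "A$i" "transpose B$j"] by (simp add: power2_norm_eq_inner)
  qed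
  also have "\<dots> = (norm A)\<^sup>2 * (norm (transpose B))\<^sup>2"
    unfolding sq[of A] sq[of "transpose B"] by (rule sum_product[symmetric])
  also have "\<dots> = (norm A * norm B)\<^sup>2"
    unfolding tr power_mult_distrib ..
  finally show ?thesis
    by (rule power2_le_imp_le) simp
qed

text \<open>This makes the rules for limits, continuity and derivatives available for matrix products.\<close>
interpretation matmul: bounded_bilinear "(**) :: real^'b^'a \<Rightarrow> real^'c^'b \<Rightarrow> real^'c^'a"
proof
  fix A A' :: "real^'b^'a" and B B' :: "real^'c^'b" and r :: real
  show "(A + A') ** B = A ** B + A' ** B" "A ** (B + B') = A ** B + A ** B'"
    by (simp_all add: matrix_matrix_mult_def vec_eq_iff sum.distrib distrib_left distrib_right)
  show "(r *\<^sub>R A) ** B = r *\<^sub>R (A ** B)" "A ** (r *\<^sub>R B) = r *\<^sub>R (A ** B)"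
    by (simp_all add: matrix_matrix_mult_def vec_eq_iff sum_distrib_left mult.assoc mult.left_commute)
  show "\<exists>K. \<forall>(A :: real^'b^'a) (B :: real^'c^'b). norm (A ** B) \<le> norm A * norm B * K"
    using norm_matrix_mult_le by (intro exI[of _ 1]) auto
qed

lemma bounded_linear_transpose: "bounded_linear (transpose :: real^'b^'a \<Rightarrow> real^'a^'b)"
  unfolding linear_conv_bounded_linear[symmetric]
  by (rule linearI) (simp_all add: transpose_def vec_eq_iff)

lemmas transpose_linear_simps =
  bounded_linear.linear[OF bounded_linear_transpose, THEN linear_add]
  bounded_linear.linear[OF bounded_linear_transpose, THEN linear_diff]
  bounded_linear.linear[OF bounded_linear_transpose, THEN linear_neg]
  bounded_linear.linear[OF bounded_linear_transpose, THEN linear_cmul]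
  bounded_linear.linear[OF bounded_linear_transpose, THEN linear_0]

lemma norm_transpose_matrix: "norm (transpose A :: real^'a^'b) = norm A"
  by (metis inner_matrix_eq_trace norm_eq_sqrt_inner trace_mul_sym transpose_transpose)

text \<open>Rewriting to sums of products that are nested to the left.\<close>
lemmas matrix_ring_simps =
  matmul.add_left matmul.add_right matmul.diff_left matmul.diff_right
  matmul.minus_left matmul.minus_right matmul.scaleR_left matmul.scaleR_right
  matmul.zero_left matmul.zero_right
  transpose_linear_simps
  matrix_transpose_mul matrix_mul_assoc

text \<open>A kernel vector would satisfy \<open>x = - (M - I) x\<close>, where \<open>M - I\<close> is a strict contraction.\<close>
lemma invertible_near_one:
  fixes M :: "real^'m^'m"
  assumes "norm (M - mat 1) < 1"
  shows "invertible M"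
proof -
  have "x = 0" if "M *v x = 0" for x
  proof (rule ccontr)
    assume "x \<noteq> 0"
    \<comment> \<open>As a one-column matrix, the vector falls under the norm estimate for products.\<close>
    define C :: "real^1^'m" where "C = columnvector x"
    have "M ** C = 0"
      using that by (simp add: C_def columnvector_def matrix_matrix_mult_def matrix_vector_mult_def vec_eq_iff)
    hence "C = - ((M - mat 1) ** C)"
      by (simp add: matrix_ring_simps)
    hence "norm C \<le> norm (M - mat 1) * norm C"
      by (metis norm_matrix_mult_le norm_minus_cancel)
    moreover have "norm C \<noteq> 0"
      using \<open>x \<noteq> 0\<close> by (auto simp: C_def columnvector_def vec_eq_iff)
    ultimately show False
      using mult_strict_right_mono[OF assms, of "norm C"] by simp
  qed
  thus ?thesis
    by (simp add: invertible_left_inverse matrix_left_invertible_ker)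
qed

lemma matrix_inv_inverse:
  fixes A :: "real^'m^'m"
  assumes "invertible A"
  shows "A ** matrix_inv A = mat 1" and "matrix_inv A ** A = mat 1"
  using assms unfolding invertible_def matrix_inv_def by (metis (mono_tags, lifting) someI_ex)+

text \<open>
  For \<open>B0 = A\<^sup>-\<^sup>1\<close>, \<open>B = A'\<^sup>-\<^sup>1\<close> and \<open>E = A' - A\<close>, the resolvent identity \<open>B = B0 - B E B0\<close> used twice gives
  the exact remainder \<open>B E B0 E B0\<close>. It is quadratic in \<open>E\<close> because \<open>B\<close> stays bounded near \<open>A\<close>.
\<close>
lemma has_derivative_matrix_inv:
  fixes A :: "real^'m^'m"
  assumes "invertible A"
  shows "(matrix_inv has_derivative (\<lambda>H. - (matrix_inv A ** H ** matrix_inv A))) (at A)"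
proof -
  define B0 where "B0 = matrix_inv A"
  have AB: "A ** B0 = mat 1" "B0 ** A = mat 1"
    using assms by (simp_all add: B0_def matrix_inv_inverse)
  have "B0 \<noteq> 0"
  proof
    assume "B0 = 0"
    hence "(mat 1 :: real^'m^'m) $ undefined $ undefined = 0"
      using AB by (simp add: matmul.zero_right flip: AB(1))
    thus False by (simp add: mat_def)
  qed
  hence b: "norm B0 > 0" by simp
  \<comment> \<open>Within this radius \<open>\<parallel>B0 E\<parallel> \<le> 1/2\<close>, which gives invertibility of \<open>A'\<close> and \<open>\<parallel>B\<parallel> \<le> 2 \<parallel>B0\<parallel>\<close>.\<close>
  define r where "r = 1 / (2 * norm B0)"
  define e where "e = (\<lambda>A'. matrix_inv A' - matrix_inv A - (- (B0 ** (A' - A) ** B0)))"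
  have r: "r > 0" using b by (simp add: r_def)
  have est: "norm (e A') \<le> 2 * norm B0 ^ 3 * (norm (A' - A))\<^sup>2" if A': "norm (A' - A) < r" for A'
  proof -
    define E where "E = A' - A"
    have half: "norm B0 * norm E \<le> 1/2"
      using A' b by (simp add: r_def E_def field_simps)
    have "norm (B0 ** A' - mat 1) = norm (B0 ** E)"
      by (simp add: E_def matrix_ring_simps AB)
    also have "\<dots> \<le> norm B0 * norm E" by (rule norm_matrix_mult_le)
    finally have "invertible (B0 ** A')"
      using half by (intro invertible_near_one) simp
    hence "invertible (A ** (B0 ** A'))"
      using assms invertible_mult by blast
    hence inv: "invertible A'" by (simp add: matrix_mul_assoc AB)
    define B where "B = matrix_inv A'"
    have BA: "B ** A' = mat 1" using inv by (simp add: B_def matrix_inv_inverse)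
    have resolvent: "B = B0 - B ** E ** B0"
      by (simp add: E_def matrix_ring_simps BA) (simp add: AB flip: matrix_mul_assoc)
    have "norm B \<le> norm B0 + norm (B ** E ** B0)"
      by (subst resolvent) (rule norm_triangle_ineq4)
    also have "norm (B ** E ** B0) \<le> norm B * norm E * norm B0"
      by (meson mult_right_mono norm_ge_zero norm_matrix_mult_le order_trans)
    also have "\<dots> \<le> norm B * (1/2)"
      using mult_left_mono[OF half norm_ge_zero[of B]] by (simp add: mult_ac)
    finally have B: "norm B \<le> 2 * norm B0" by simp
    have "e A' = B - B0 + B0 ** E ** B0"
      by (simp add: e_def B_def B0_def E_def)
    also have "\<dots> = B ** E ** B0 ** E ** B0"
    proof -
      have d: "B - B0 = - (B ** E ** B0)" using resolvent by (simp add: algebra_simps)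
      have "B - B0 + B0 ** E ** B0 = - ((B - B0) ** E ** B0)"
        unfolding matmul.diff_left by (simp add: d)
      thus ?thesis unfolding d by (simp add: matmul.minus_left)
    qed
    also have "norm \<dots> \<le> norm B * norm E * norm B0 * norm E * norm B0"
      by (intro order_trans[OF norm_matrix_mult_le] mult_right_mono norm_ge_zero order_refl)
    also have "\<dots> = norm B * (norm B0 ^ 2 * norm E ^ 2)"
      by (simp add: power2_eq_square mult_ac)
    also have "\<dots> \<le> 2 * norm B0 * (norm B0 ^ 2 * norm E ^ 2)"
      using B by (intro mult_right_mono) auto
    finally show ?thesis by (simp add: E_def power_def mult_ac eval_nat_numeral)
  qed
  show ?thesis
    unfolding B0_def[symmetric]
  proof (rule has_derivativeI_sandwich[OF r])
    show "bounded_linear (\<lambda>H. - (B0 ** H ** B0))"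
      by (intro bounded_linear_minus bounded_linear_compose[OF matmul.bounded_linear_left]
          matmul.bounded_linear_right)
    show "norm (matrix_inv A' - matrix_inv A - - (B0 ** (A' - A) ** B0)) / norm (A' - A)
            \<le> 2 * norm B0 ^ 3 * norm (A' - A)" if "A' \<noteq> A" "dist A' A < r" for A'
      using est[of A'] that by (simp add: e_def dist_norm field_simps power2_eq_square)
    show "(\<lambda>A'. 2 * norm B0 ^ 3 * norm (A' - A)) \<midarrow>A\<rightarrow> 0"
      by (auto intro!: tendsto_eq_intros)
  qed
qed

lemma inner_transpose_matrix: "transpose A \<bullet> transpose B = (A :: real^'b^'a) \<bullet> B"
proof -
  have "transpose A \<bullet> transpose B = trace (A ** transpose B)"
    by (simp add: inner_matrix_eq_trace)
  also have "\<dots> = trace (transpose B ** A)" by (rule trace_mul_sym)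
  also have "\<dots> = A \<bullet> B"
    unfolding inner_matrix_eq_trace[symmetric] by (rule inner_commute)
  finally show ?thesis .
qed

lemma inner_matrix_mult_left: "A \<bullet> (B ** C) = (transpose B ** A) \<bullet> (C :: real^'c^'b)"
  by (simp add: inner_matrix_eq_trace matrix_ring_simps)

lemma inner_matrix_mult_right: "A \<bullet> (B ** C) = (A ** transpose C) \<bullet> (B :: real^'b^'a)"
proof -
  have "A \<bullet> (B ** C) = transpose A \<bullet> (transpose C ** transpose B)"
    by (simp add: inner_transpose_matrix flip: matrix_transpose_mul)
  also have "\<dots> = transpose (A ** transpose C) \<bullet> transpose B"
    by (simp add: inner_matrix_mult_left matrix_transpose_mul)
  finally show ?thesis by (simp only: inner_transpose_matrix)
qed

lemma transpose_matrix_inv: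
  fixes P :: "real^'m^'m"
  assumes "invertible P" "transpose P = P"
  shows "transpose (matrix_inv P) = matrix_inv P"
proof -
  have "transpose (matrix_inv P) ** P = transpose (P ** matrix_inv P)"
    by (simp add: matrix_transpose_mul assms)
  hence left: "transpose (matrix_inv P) ** P = mat 1"
    by (simp add: matrix_inv_inverse assms)
  have "transpose (matrix_inv P) = transpose (matrix_inv P) ** (P ** matrix_inv P)"
    by (simp add: matrix_inv_inverse assms)
  also have "\<dots> = matrix_inv P"
    unfolding matrix_mul_assoc left by simp
  finally show ?thesis .
qed

lemma transpose_skew: "transpose (skew A) = - skew A"
  by (simp add: skew_def transpose_linear_simps scaleR_diff_right)

lemma norm_skew_le: "norm (skew A) \<le> norm A"
proof -
  have "norm (A - transpose A) \<le> 2 * norm A"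
    using norm_triangle_ineq4[of A "transpose A"] by (simp add: norm_transpose_matrix)
  thus ?thesis by (simp add: skew_def)
qed

lemma bounded_linear_skew: "bounded_linear skew"
  unfolding skew_def[abs_def]
  by (intro bounded_linear_compose[OF bounded_linear_scaleR_right] bounded_linear_sub
      bounded_linear_ident bounded_linear_transpose)

section \<open>Geometry of the layered manifolds\<close>

text \<open>In this form the adjoint rules for the Frobenius inner product apply to the metric.\<close>
lemma layer_metric_eq_inner:
  "layer_metric X \<xi> \<eta> =
     \<xi> \<bullet> ((mat 1 - (1/2) *\<^sub>R (X ** matrix_inv (transpose X ** X) ** transpose X))
          ** \<eta> ** matrix_inv (transpose X ** X))"
  unfolding layer_metric_def inner_matrix_eq_trace by (simp only: matrix_mul_assoc)

lemma gram_symmetric: "transpose (transpose X ** X) = transpose X ** (X :: real^'p^'n)"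
  by (simp add: matrix_transpose_mul)

lemma subspace_tangent_layer: "subspace (tangent_layer X)"
proof -
  have "linear (\<lambda>\<xi>. transpose \<xi> ** X + transpose X ** \<xi>)"
    by (rule linearI)
       (simp_all add: matmul.add_left matmul.add_right matmul.scaleR_left matmul.scaleR_right
          transpose_linear_simps scaleR_add_right)
  thus ?thesis
    unfolding tangent_layer_def by (rule linear_subspace_kernel)
qed

lemma skew_mult_tangent: "(2 *\<^sub>R skew Z) ** X \<in> tangent_layer X"
proof -
  have "transpose (skew Z ** X) ** X + transpose X ** (skew Z ** X) = 0"
    by (simp add: matrix_transpose_mul transpose_skew matmul.minus_left matmul.minus_right matrix_mul_assoc)
  thus ?thesis
    by (simp add: tangent_layer_def matmul.scaleR_left matmul.scaleR_right transpose_linear_simps flip: scaleR_add_right)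
qed

text \<open>
  Tangency means that \<open>X\<^sup>T \<xi>\<close> is skew-symmetric, and skew-symmetric matrices are orthogonal to
  symmetric ones.
\<close>
lemma tangent_orthogonal_symmetric:
  assumes "\<xi> \<in> tangent_layer X" "transpose S = S"
  shows "\<xi> \<bullet> (X ** S) = 0"
proof -
  define B where "B = transpose X ** \<xi>"
  have "transpose B + B = 0"
    using assms(1) by (simp add: B_def tangent_layer_def matrix_transpose_mul)
  hence "transpose B = - B"
    by (rule eq_neg_iff_add_eq_0[THEN iffD2])
  hence "B \<bullet> S = - (B \<bullet> S)"
    using inner_transpose_matrix[of B S] assms(2) by (metis inner_minus_left)
  thus ?thesis unfolding inner_matrix_mult_left B_def by linarith
qed

text \<open>
  The coordinates of the derivative form a gradient, and a gradient is unique because a vector is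
  determined by its inner products. So the definite description in \<open>egrad\<close> denotes it.
\<close>
lemma has_derivative_egrad:
  assumes "f differentiable (at x)"
  shows "(f has_derivative (\<lambda>h. h \<bullet> egrad f x)) (at x)"
proof -
  obtain f' where f': "(f has_derivative f') (at x)"
    using assms by (auto simp: differentiable_def)
  define D where "D = (\<Sum>b\<in>Basis. f' b *\<^sub>R b)"
  interpret f': linear f' using f' by (rule has_derivative_linear)
  have "f' h = h \<bullet> D" for h
  proof -
    have "f' h = f' (\<Sum>b\<in>Basis. (h \<bullet> b) *\<^sub>R b)" by (simp only: euclidean_representation)
    also have "\<dots> = h \<bullet> D"
      by (simp only: f'.sum f'.scaleR D_def inner_sum_right inner_scaleR_right real_scaleR_def mult.commute)
    finally show ?thesis .
  qed
  hence "f' = (\<lambda>h. h \<bullet> D)" by (rule ext)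
  hence D: "GDERIV f x :> D" using f' by (simp add: gderiv_def)
  moreover have "D' = D" if "GDERIV f x :> D'" for D'
  proof -
    have "(\<lambda>h. h \<bullet> D') = (\<lambda>h. h \<bullet> D)"
      using that D unfolding gderiv_def by (rule has_derivative_unique)
    hence "h \<bullet> D' = h \<bullet> D" for h by (rule fun_cong)
    thus ?thesis using vector_eq_ldot[of D' D] by blast
  qed
  ultimately have "egrad f x = D" unfolding egrad_def by (rule the_equality)
  thus ?thesis using D by (simp add: gderiv_def)
qed

lemma has_derivative_ehess:
  assumes "egrad f differentiable (at x)"
  shows "(egrad f has_derivative blinfun_apply (ehess f x)) (at x)"
proof -
  have "(egrad f has_derivative frechet_derivative (egrad f) (at x)) (at x)"
    using assms frechet_derivative_works by blast
  thus ?thesis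
    unfolding ehess_def by (simp add: bounded_linear_Blinfun_apply has_derivative_bounded_linear)
qed

context
  fixes X :: "real^'p^'n" and K
  assumes inv: "invertible (transpose X ** X)"
  defines "K \<equiv> matrix_inv (transpose X ** X)"
begin

private lemma K: "transpose X ** X ** K = mat 1" "K ** (transpose X ** X) = mat 1" "transpose K = K"
  unfolding K_def
  by (rule matrix_inv_inverse[OF inv] transpose_matrix_inv[OF inv gram_symmetric])+

private lemma K_cancel: "A ** transpose X ** X ** K = A" "A ** K ** transpose X ** X = A"
proof -
  have "A ** transpose X ** X ** K = A ** (transpose X ** X ** K)"
    and "A ** K ** transpose X ** X = A ** (K ** (transpose X ** X))"
    by (simp_all only: matrix_mul_assoc)
  thus "A ** transpose X ** X ** K = A" "A ** K ** transpose X ** X = A"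
    by (simp_all only: K matrix_mul_rid)
qed

lemma layer_metric_sym: "layer_metric X \<xi> \<eta> = layer_metric X \<eta> \<xi>"
proof -
  let ?R = "mat 1 - (1/2) *\<^sub>R (X ** K ** transpose X)"
  have R: "transpose ?R = ?R"
    by (simp add: matrix_ring_simps K)
  have "\<xi> \<bullet> (?R ** \<eta> ** K) = (?R ** \<xi> ** K) \<bullet> \<eta>"
    by (simp only: inner_matrix_mult_right[of \<xi> "?R ** \<eta>" K]
        inner_matrix_mult_left[of _ ?R \<eta>] R K matrix_mul_assoc)
  thus ?thesis
    unfolding layer_metric_eq_inner K_def[symmetric] by (simp only: inner_commute)
qed

text \<open>
  Since \<open>K = Z\<^sup>T Z\<close> for \<open>Z = X K\<close>, the metric is \<open>\<langle>M, (I - Q/2) M\<rangle>\<close> with \<open>M = \<eta> Z\<^sup>T\<close> and the orthogonal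
  projection \<open>Q = X K X\<^sup>T\<close>. This is at least \<open>\<parallel>M\<parallel>\<^sup>2 / 2\<close>, and \<open>M = 0\<close> forces \<open>\<eta> = 0\<close>.
\<close>
lemma layer_metric_definite:
  assumes "layer_metric X \<eta> \<eta> = 0"
  shows "\<eta> = 0"
proof -
  define Z where "Z = X ** K"
  define M where "M = \<eta> ** transpose Z"
  define Q where "Q = X ** K ** transpose X"
  have Z: "transpose Z ** Z = K"
    by (simp only: Z_def matrix_transpose_mul K matrix_mul_assoc K_cancel)
  have Q: "transpose Q = Q" "Q ** Q = Q"
    by (simp_all only: Q_def matrix_transpose_mul K matrix_mul_assoc K_cancel transpose_transpose)
  have "layer_metric X \<eta> \<eta> = \<eta> \<bullet> ((mat 1 - (1/2) *\<^sub>R Q) ** \<eta> ** (transpose Z ** Z))"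
    by (simp add: layer_metric_eq_inner Z Q_def K_def)
  also have "\<dots> = M \<bullet> ((mat 1 - (1/2) *\<^sub>R Q) ** M)"
    by (simp add: inner_matrix_mult_right[of \<eta> _ Z] matrix_mul_assoc M_def)
  also have "\<dots> = (norm M)\<^sup>2 - (1/2) * (M \<bullet> (Q ** M))"
    by (simp add: matrix_ring_simps inner_diff_right power2_norm_eq_inner)
  finally have split: "(norm M)\<^sup>2 = (1/2) * (M \<bullet> (Q ** M))"
    using assms by simp
  have proj: "M \<bullet> (Q ** M) = (norm (Q ** M))\<^sup>2"
  proof -
    have "M \<bullet> (Q ** M) = M \<bullet> (Q ** (Q ** M))" by (simp only: matrix_mul_assoc Q)
    also have "\<dots> = (Q ** M) \<bullet> (Q ** M)" by (subst inner_matrix_mult_left) (simp only: Q)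
    finally show ?thesis by (simp only: power2_norm_eq_inner)
  qed
  have "M \<bullet> (Q ** M) \<le> norm M * norm (Q ** M)"
    by (rule norm_cauchy_schwarz)
  hence "norm (Q ** M) \<le> norm M"
    unfolding proj power2_eq_square by (cases "norm (Q ** M) = 0") auto
  hence "(norm (Q ** M))\<^sup>2 \<le> (norm M)\<^sup>2"
    by (simp add: power_mono)
  hence "(norm M)\<^sup>2 \<le> (1/2) * (norm M)\<^sup>2"
    using split proj by simp
  hence "M = 0" by simp
  hence "\<eta> ** K ** transpose X ** X = 0"
    by (simp add: M_def Z_def matrix_ring_simps K)
  thus "\<eta> = 0"
    by (simp only: K_cancel)
qed

lemma layer_metric_nondegenerate:
  assumes "\<And>\<zeta>. layer_metric X \<gamma> \<zeta> = 0"
  shows "\<gamma> = 0"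
  using assms layer_metric_definite by blast

text \<open>
  Tangent and normal space meet only in \<open>0\<close>: the tangency condition turns \<open>X K S\<close> with symmetric
  \<open>S\<close> into \<open>2 S = 0\<close>.
\<close>
lemma tangent_proj_tangent:
  assumes V: "V \<in> tangent_layer X"
  shows "tangent_proj X V = V"
  unfolding tangent_proj_def
proof (rule the_equality)
  show "V \<in> tangent_layer X \<and> V - V \<in> normal_layer X"
  proof
    have "V - V = X ** matrix_inv (transpose X ** X) ** 0 \<and> transpose 0 = (0 :: real^'p^'p)"
      by (simp add: matmul.zero_right transpose_linear_simps)
    thus "V - V \<in> normal_layer X" unfolding normal_layer_def by blast
  qed (rule V)
  fix \<xi> assume "\<xi> \<in> tangent_layer X \<and> V - \<xi> \<in> normal_layer X"
  then obtain S where \<xi>: "\<xi> \<in> tangent_layer X" and S: "V - \<xi> = X ** K ** S" "transpose S = S"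
    unfolding normal_layer_def K_def by blast
  have "transpose (V - \<xi>) ** X + transpose X ** (V - \<xi>)
      = (transpose V ** X + transpose X ** V) - (transpose \<xi> ** X + transpose X ** \<xi>)"
    by (simp add: matmul.diff_left matmul.diff_right transpose_linear_simps)
  hence "0 = transpose (V - \<xi>) ** X + transpose X ** (V - \<xi>)"
    using V \<xi> by (simp add: tangent_layer_def)
  also have "\<dots> = S ** (K ** (transpose X ** X)) + (transpose X ** X ** K) ** S"
    by (simp only: S matrix_transpose_mul K matrix_mul_assoc)
  also have "\<dots> = 2 *\<^sub>R S"
    by (simp only: K) (simp add: scaleR_2)
  finally have "S = 0" by simp
  thus "\<xi> = V" using S by (simp add: matmul.zero_right)
qed

text \<open>
  The operator of the metric maps the candidate \<open>F\<close> to \<open>G - X S / 2\<close> with a symmetric matrix \<open>S\<close>,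
  and \<open>X S\<close> is orthogonal to all tangent vectors. Definiteness of the metric gives uniqueness.
\<close>
lemma rgrad_eq:
  assumes f: "f differentiable (at X)"
  shows "rgrad f X = (2 *\<^sub>R skew (egrad f X ** transpose X)) ** X"
  unfolding rgrad_def
proof (rule the_equality)
  define G where "G = egrad f X"
  define F where "F = (2 *\<^sub>R skew (G ** transpose X)) ** X"
  define Q where "Q = X ** K ** transpose X"
  define S where "S = transpose G ** X ** K + K ** transpose X ** G"
  have fd: "frechet_derivative f (at X) \<xi> = \<xi> \<bullet> G" for \<xi>
    using frechet_derivative_at[OF has_derivative_egrad[OF f]] by (simp add: G_def fun_eq_iff)
  have S: "transpose S = S"
    by (simp add: S_def matrix_ring_simps K)
  have FK: "F ** K = G - X ** transpose G ** X ** K"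
    by (simp add: F_def skew_def matrix_ring_simps K_cancel)
  have QX: "Q ** X = X"
  proof -
    have "Q ** X = X ** (K ** (transpose X ** X))" by (simp only: Q_def matrix_mul_assoc)
    thus ?thesis by (simp only: K matrix_mul_rid)
  qed
  have "(mat 1 - (1/2) *\<^sub>R Q) ** F ** K = F ** K - (1/2) *\<^sub>R (Q ** (F ** K))"
    by (simp add: matrix_ring_simps)
  also have "Q ** (F ** K) = Q ** G - X ** transpose G ** X ** K"
    unfolding FK by (simp add: matrix_ring_simps QX)
  also have "F ** K - (1/2) *\<^sub>R (Q ** G - X ** transpose G ** X ** K) = G - (1/2) *\<^sub>R (X ** S)"
  proof -
    have "X ** S = Q ** G + X ** transpose G ** X ** K"
      by (simp add: S_def Q_def matrix_ring_simps)
    moreover have "a - b - (1/2) *\<^sub>R (q - b) = a - (1/2) *\<^sub>R (q + b)" for a b q :: "real^'p^'n"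
      by (simp add: vec_eq_iff field_simps)
    ultimately show ?thesis by (simp add: FK)
  qed
  finally have metric: "layer_metric X F \<xi> = \<xi> \<bullet> G" if "\<xi> \<in> tangent_layer X" for \<xi>
    using tangent_orthogonal_symmetric[OF that S]
    by (subst layer_metric_sym) (simp add: layer_metric_eq_inner K_def Q_def inner_diff_right)
  have tan: "F \<in> tangent_layer X" unfolding F_def by (rule skew_mult_tangent)
  show "F \<in> tangent_layer X \<and> (\<forall>\<xi>\<in>tangent_layer X. layer_metric X F \<xi> = frechet_derivative f (at X) \<xi>)"
    using tan metric by (simp add: fd)
  fix F' assume F': "F' \<in> tangent_layer X \<and> (\<forall>\<xi>\<in>tangent_layer X. layer_metric X F' \<xi> = frechet_derivative f (at X) \<xi>)"
  hence "F' - F \<in> tangent_layer X" using tan subspace_diff subspace_tangent_layer by blast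
  hence "layer_metric X (F' - F) (F' - F) = 0"
    using F' metric by (simp add: fd layer_metric_eq_inner inner_diff_left)
  thus "F' = F" using layer_metric_definite by fastforce
qed

end

section \<open>Critical points and the Riemannian Hessian\<close>

lemma differentiable_matrix_mult:
  fixes f :: "'a::real_normed_vector \<Rightarrow> real^'b^'c" and g :: "'a \<Rightarrow> real^'d^'b"
  assumes "f differentiable (at x)" "g differentiable (at x)"
  shows "(\<lambda>x. f x ** g x) differentiable (at x)"
  using assms matmul.FDERIV unfolding differentiable_def by blast

lemma differentiable_matrix_transpose:
  fixes f :: "'a::real_normed_vector \<Rightarrow> real^'b^'c"
  assumes "f differentiable (at x)"
  shows "(\<lambda>x. transpose (f x)) differentiable (at x)"
  using assms bounded_linear.has_derivative[OF bounded_linear_transpose]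
  unfolding differentiable_def by blast

text \<open>
  At a point where the metric is not differentiable, \<open>metric_deriv\<close> would be an arbitrary function.
  Differentiability guarantees in particular that it is linear in the direction.
\<close>
lemma differentiable_layer_metric:
  fixes X :: "real^'p^'n"
  assumes "invertible (transpose X ** X)"
  shows "(\<lambda>Z. layer_metric Z \<xi> \<eta>) differentiable (at X)"
proof -
  have gram: "(\<lambda>Z :: real^'p^'n. transpose Z ** Z) differentiable (at X)"
    by (intro differentiable_matrix_mult differentiable_matrix_transpose differentiable_ident)
  have "matrix_inv differentiable (at (transpose X ** X))"
    using has_derivative_matrix_inv[OF assms] unfolding differentiable_def by blast
  from differentiable_chain_at[OF gram this]
  have inv: "(\<lambda>Z :: real^'p^'n. matrix_inv (transpose Z ** Z)) differentiable (at X)"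
    by (simp add: o_def)
  show ?thesis
    unfolding layer_metric_eq_inner
    by (intro differentiable_inner differentiable_matrix_mult differentiable_diff
        differentiable_scaleR differentiable_const differentiable_ident
        differentiable_matrix_transpose inv)
qed

text \<open>
  In the Koszul formula two terms differentiate a constant function, as the metric vanishes on a
  zero argument, and the third is a derivative in direction \<open>0\<close>. Nondegeneracy of the metric
  determines the Christoffel form.
\<close>
lemma christoffel_zero_right:
  fixes X :: "real^'p^'n"
  assumes inv: "invertible (transpose X ** X)"
  shows "christoffel layer_metric X \<xi> 0 = 0"
proof -
  have zero: "layer_metric Z \<zeta> 0 = 0" "layer_metric Z 0 \<zeta> = 0" for Z \<zeta> :: "real^'p^'n"
    by (simp_all add: layer_metric_eq_inner matmul.zero_left matmul.zero_right)
  have lin: "metric_deriv layer_metric X 0 \<xi> \<zeta> = 0" for \<zeta>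
  proof -
    have "linear (frechet_derivative (\<lambda>Z. layer_metric Z \<xi> \<zeta>) (at X))"
      using differentiable_layer_metric[OF inv] by (rule linear_frechet_derivative)
    thus ?thesis unfolding metric_deriv_def by (rule linear_0)
  qed
  have "metric_deriv layer_metric X \<xi> 0 \<zeta> + metric_deriv layer_metric X 0 \<xi> \<zeta>
      - metric_deriv layer_metric X \<zeta> \<xi> 0 = 0" for \<zeta>
    unfolding lin by (simp add: metric_deriv_def zero)
  hence "christoffel layer_metric X \<xi> 0 = (THE \<gamma>. \<forall>\<zeta>. 2 * layer_metric X \<gamma> \<zeta> = 0)"
    unfolding christoffel_def by simp
  also have "\<dots> = 0"
    using zero layer_metric_nondegenerate[OF inv] by (intro the_equality) auto
  finally show ?thesis .
qed

text \<open>
  If \<open>A\<^sup>3 = - A\<close>, then Rodrigues' formula \<open>exp (t A) = I + sin t A + (1 - cos t) A\<^sup>2\<close> holds. For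
  skew-symmetric \<open>A\<close> this is a rotation, so its product with \<open>X\<close> is a curve in the Stiefel manifold
  with initial velocity \<open>A X\<close>.
\<close>
lemma stiefel_rotation:
  fixes A :: "real^'n^'n" and X :: "real^'p^'n"
  assumes X: "X \<in> stiefel" and skew: "transpose A = - A" and cube: "A ** A ** A = - A"
  shows "X + sin t *\<^sub>R (A ** X) + (1 - cos t) *\<^sub>R (A ** A ** X) \<in> stiefel"
proof -
  define R where "R = mat 1 + sin t *\<^sub>R A + (1 - cos t) *\<^sub>R (A ** A)"
  have quartic: "A ** A ** A ** A = - (A ** A)"
    by (simp add: cube matmul.minus_left)
  have RT: "transpose R = mat 1 - sin t *\<^sub>R A + (1 - cos t) *\<^sub>R (A ** A)"
    by (simp add: R_def transpose_linear_simps matrix_transpose_mul skew matmul.minus_left matmul.minus_right)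
  have expand: "(mat 1 - s *\<^sub>R A + c *\<^sub>R (A ** A)) ** (mat 1 + s *\<^sub>R A + c *\<^sub>R (A ** A))
      = mat 1 + (2 * c - s * s - c * c) *\<^sub>R (A ** A)" for s c :: real
    by (simp add: matmul.add_left matmul.add_right matmul.diff_left matmul.diff_right
        matmul.scaleR_left matmul.scaleR_right matrix_mul_assoc cube quartic)
       (simp add: vec_eq_iff algebra_simps)
  have "2 * (1 - cos t) - sin t * sin t - (1 - cos t) * (1 - cos t) = 0"
    using sin_cos_squared_add[of t] by (simp add: power2_eq_square algebra_simps)
  hence "transpose R ** R = mat 1"
    unfolding RT unfolding R_def expand by simp
  hence "transpose X ** (transpose R ** R) ** X = mat 1"
    using X by (simp add: stiefel_def)
  moreover have "X + sin t *\<^sub>R (A ** X) + (1 - cos t) *\<^sub>R (A ** A ** X) = R ** X"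
    by (simp add: R_def matmul.add_left matmul.scaleR_left)
  ultimately show ?thesis
    by (simp add: stiefel_def matrix_transpose_mul matrix_mul_assoc)
qed

lemma inner_rotation_generator_eq_0:
  fixes A :: "real^'n^'n" and X :: "real^'p^'n"
  assumes min: "local_minimizer_over stiefel f X" and f: "f differentiable (at X)"
    and skew: "transpose A = - A" and cube: "A ** A ** A = - A"
  shows "egrad f X \<bullet> (A ** X) = 0"
proof -
  define c where "c = (\<lambda>t. X + sin t *\<^sub>R (A ** X) + (1 - cos t) *\<^sub>R (A ** A ** X))"
  have c0: "c 0 = X" by (simp add: c_def)
  have dc: "(c has_derivative (\<lambda>h. h *\<^sub>R (A ** X))) (at 0)"
    unfolding c_def by (auto intro!: derivative_eq_intros)
  have "((\<lambda>t. f (c t)) has_derivative (\<lambda>h. (h *\<^sub>R (A ** X)) \<bullet> egrad f X)) (at 0)"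
    using has_derivative_compose[OF dc, of f "\<lambda>h. h \<bullet> egrad f X"] has_derivative_egrad[OF f] c0
    by simp
  hence der: "((\<lambda>t. f (c t)) has_real_derivative (egrad f X \<bullet> (A ** X))) (at 0)"
    unfolding has_field_derivative_def by (simp add: inner_commute mult_commute_abs)
  from min obtain r where X: "X \<in> stiefel" and r: "r > 0" "\<And>Y. Y \<in> stiefel \<inter> ball X r \<Longrightarrow> f X \<le> f Y"
    unfolding local_minimizer_over_def by blast
  have "isCont c 0" using dc has_derivative_continuous by blast
  then obtain d where d: "d > 0" "\<And>t. \<bar>t\<bar> < d \<Longrightarrow> dist (c t) X < r"
    using r(1) unfolding continuous_at_eps_delta by (auto simp: c0)
  have "f (c 0) \<le> f (c t)" if "\<bar>0 - t\<bar> < d" for t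
    using r(2)[of "c t"] d(2)[of t] that stiefel_rotation[OF X skew cube, of t]
    by (simp add: c_def dist_commute)
  with der d(1) show ?thesis by (intro DERIV_local_min) auto
qed

text \<open>
  The generator \<open>A = e\<^sub>i e\<^sub>j\<^sup>T - e\<^sub>j e\<^sub>i\<^sup>T\<close> of a plane rotation extracts from stationarity of \<open>f\<close> that the
  entries \<open>(i, j)\<close> and \<open>(j, i)\<close> of \<open>G X\<^sup>T\<close> agree.
\<close>
lemma first_order_condition:
  fixes X :: "real^'p^'n"
  assumes min: "local_minimizer_over stiefel f X" and f: "f differentiable (at X)"
  shows "skew (egrad f X ** transpose X) = 0"
proof -
  define M where "M = egrad f X ** transpose X"
  have sym: "M $ i $ j = M $ j $ i" if "i \<noteq> j" for i j
  proof -
    define A :: "real^'n^'n" where "A = axis i (axis j 1) - axis j (axis i 1)"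
    have unit: "axis k (axis l 1) ** B = axis k (B $ l)" for B :: "real^'n^'n" and k l :: 'n
      by (auto simp: vec_eq_iff matrix_matrix_mult_def axis_def if_distrib[of "\<lambda>x. x * _"] cong: if_cong)
    have mult: "A ** B = axis i (B $ j) - axis j (B $ i)" for B :: "real^'n^'n"
      by (simp add: A_def matmul.diff_left unit)
    have "transpose A = - A"
      by (auto simp: A_def transpose_def vec_eq_iff axis_def)
    moreover have "A ** (A ** A) = - A"
      using that unfolding mult by (auto simp: A_def vec_eq_iff axis_def)
    hence "A ** A ** A = - A" by (simp only: matrix_mul_assoc)
    ultimately have "egrad f X \<bullet> (A ** X) = 0"
      using inner_rotation_generator_eq_0[OF min f] by blast
    hence "M \<bullet> A = 0"
      by (simp add: inner_matrix_mult_right M_def)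
    thus ?thesis
      by (simp add: A_def inner_diff_right inner_axis)
  qed
  have "M $ i $ j = M $ j $ i" for i j
    by (cases "i = j") (simp_all add: sym)
  hence "transpose M = M" by (simp add: transpose_def vec_eq_iff)
  thus ?thesis by (simp add: skew_def M_def)
qed

text \<open>
  Multiplied by \<open>X\<close> from the right, this derivative in direction \<open>V\<close> is \<open>A_op f X V\<close>. Hence \<open>A_op\<close> is the derivative of
  the gradient field \<open>W(X) X\<close> except for the term \<open>W(X) V\<close>.
\<close>
lemma has_derivative_skew_egrad:
  assumes "egrad f differentiable (at X)"
  shows "((\<lambda>Z. 2 *\<^sub>R skew (egrad f Z ** transpose Z)) has_derivative
     (\<lambda>V. 2 *\<^sub>R skew (blinfun_apply (ehess f X) V ** transpose X + egrad f X ** transpose V))) (at X)"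
proof -
  note transp = bounded_linear.has_derivative[OF bounded_linear_transpose has_derivative_ident]
  have "((\<lambda>Z. egrad f Z ** transpose Z) has_derivative
      (\<lambda>V. egrad f X ** transpose V + blinfun_apply (ehess f X) V ** transpose X)) (at X)"
    by (rule matmul.FDERIV[OF has_derivative_ehess[OF assms] transp])
  from has_derivative_scaleR_right[OF bounded_linear.has_derivative[OF bounded_linear_skew this]]
  show ?thesis by (simp only: add.commute)
qed

lemma A_op_tangent: "A_op f X V \<in> tangent_layer X"
  unfolding A_op_def by (rule skew_mult_tangent)

text \<open>
  At a critical point the term \<open>W(X) \<xi>\<close> in the derivative of the gradient field vanishes, and so
  does the Christoffel term, since the field itself is zero there. What remains is tangent and is
  therefore fixed by the projection.
\<close>
lemma rhess_eq_A_op: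
  fixes X :: "real^'p^'n"
  assumes X: "X \<in> stiefel" and U: "open U" "X \<in> U" "\<And>Z. Z \<in> U \<Longrightarrow> f differentiable (at Z)"
    and G: "egrad f differentiable (at X)"
    and crit: "skew (egrad f X ** transpose X) = 0"
  shows "rhess f X \<xi> = A_op f X \<xi>"
proof -
  define F where "F = (\<lambda>Z. (2 *\<^sub>R skew (egrad f Z ** transpose Z)) ** Z)"
  have P: "transpose X ** X = mat 1" using X by (simp add: stiefel_def)
  have inv: "invertible (transpose X ** X)" unfolding P invertible_def by (metis matrix_mul_lid)
  \<comment> \<open>On this neighbourhood the Gram matrix is invertible, so \<open>F\<close> agrees with the gradient field.\<close>
  define V where "V = U \<inter> {Z. norm (transpose Z ** Z - mat 1) < 1}"
  have "open {Z :: real^'p^'n. norm (transpose Z ** Z - mat 1) < 1}"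
    by (intro open_Collect_less continuous_intros matmul.continuous_on
        bounded_linear.continuous_on[OF bounded_linear_transpose])
  hence "open V" using U by (auto simp: V_def)
  have "X \<in> V" using U P by (auto simp: V_def)
  have eq: "F Z = rgrad f Z" if "Z \<in> V" for Z
    using that by (simp add: V_def F_def rgrad_eq U(3) invertible_near_one)
  have "(F has_derivative (\<lambda>V. A_op f X V + 0)) (at X)"
    unfolding F_def
    by (rule has_derivative_eq_rhs[OF matmul.FDERIV[OF has_derivative_skew_egrad[OF G] has_derivative_ident]])
       (simp add: A_op_def crit matmul.zero_left fun_eq_iff)
  hence "(rgrad f has_derivative (A_op f X)) (at X)"
    using has_derivative_transform_within_open[OF _ \<open>open V\<close> \<open>X \<in> V\<close> eq] by simp
  hence "frechet_derivative (rgrad f) (at X) = A_op f X"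
    by (rule frechet_derivative_at[symmetric])
  moreover have "rgrad f X = 0"
    using eq[OF \<open>X \<in> V\<close>] by (simp add: F_def crit matmul.zero_left)
  ultimately show ?thesis
    by (simp add: rhess_def levi_civita_def christoffel_zero_right[OF inv]
        tangent_proj_tangent[OF inv A_op_tangent])
qed

section \<open>Uniform invertibility and existence of the tangent step\<close>

text \<open>
  On the compact unit sphere \<open>\<parallel>M x0 v\<parallel>\<close> has a positive minimum \<open>2 m\<close>, and by uniform continuity
  \<open>\<parallel>M x v\<parallel>\<close> stays above \<open>m\<close> for all \<open>x\<close> near \<open>x0\<close>. Scaling extends this to all vectors.
\<close>
lemma injective_family_lower_bound:
  fixes M :: "'a::euclidean_space \<Rightarrow> 'b::euclidean_space \<Rightarrow> 'c::real_normed_vector"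
  assumes r0: "r0 > 0"
    and cont: "continuous_on (cball x0 r0 \<times> UNIV) (\<lambda>(x, v). M x v)"
    and lin: "\<And>x. x \<in> cball x0 r0 \<Longrightarrow> linear (M x)"
    and inj: "\<And>v. M x0 v = 0 \<Longrightarrow> v = 0"
  obtains m r where "m > 0" "r > 0" "r \<le> r0"
    "\<And>x v. x \<in> ball x0 r \<Longrightarrow> m * norm v \<le> norm (M x v)"
proof -
  define h where "h = (\<lambda>p. norm (M (fst p) (snd p)))"
  let ?S = "sphere 0 1 :: 'b set"
  have cont_h: "continuous_on (cball x0 r0 \<times> ?S) h"
    unfolding h_def
    by (intro continuous_on_norm continuous_on_subset[OF cont[unfolded case_prod_unfold]]) auto
  hence uc: "uniformly_continuous_on (cball x0 r0 \<times> ?S) h"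
    by (intro compact_uniformly_continuous compact_Times) auto
  have "continuous_on ?S (\<lambda>v. h (x0, v))"
    by (rule continuous_on_compose2[OF cont_h]) (use r0 in \<open>auto intro!: continuous_intros\<close>)
  then obtain v0 where v0: "v0 \<in> ?S" "\<And>v. v \<in> ?S \<Longrightarrow> h (x0, v0) \<le> h (x0, v)"
    using continuous_attains_inf[of ?S "\<lambda>v. h (x0, v)"] by auto
  define m where "m = h (x0, v0) / 2"
  have "v0 \<noteq> 0" using v0(1) by auto
  hence m: "m > 0" using inj[of v0] by (auto simp: m_def h_def)
  obtain d where d: "d > 0"
    "\<And>p q. p \<in> cball x0 r0 \<times> ?S \<Longrightarrow> q \<in> cball x0 r0 \<times> ?S \<Longrightarrow> dist q p < d \<Longrightarrow> dist (h q) (h p) < m"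
    by (rule uniformly_continuous_onE[OF uc m]) blast
  have "m * norm v \<le> norm (M x v)" if x: "x \<in> ball x0 (min d r0)" for x v
  proof (cases "v = 0")
    case False
    define u where "u = v /\<^sub>R norm v"
    have u: "u \<in> ?S" using False by (simp add: u_def)
    have xc: "x \<in> cball x0 r0" using x by simp
    have "dist (x, u) (x0, u) < d" using x by (simp add: dist_Pair_Pair dist_commute)
    hence "dist (h (x, u)) (h (x0, u)) < m" using d(2) u xc r0 by auto
    hence "m \<le> h (x, u)" using v0(2)[OF u] unfolding m_def dist_real_def by linarith
    also have "h (x, u) = norm (M x v) / norm v"
      using linear_scale[OF lin[OF xc], of "inverse (norm v)" v]
      by (simp add: h_def u_def divide_inverse mult.commute)
    finally show ?thesis using False by (simp add: field_simps)
  next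
    case True
    thus ?thesis by simp
  qed
  moreover have "min d r0 > 0" using d r0 by simp
  ultimately show thesis using that[of m "min d r0"] m by simp
qed

text \<open>
  On the segment from \<open>X\<close> to \<open>Y\<close> the Hessian differs from its value at \<open>X\<close> by at most
  \<open>L \<parallel>Y - X\<parallel>\<close>, so the claim is the mean value inequality for \<open>egrad f\<close> minus its linearization.
\<close>
lemma egrad_taylor:
  assumes conv: "convex S" and X: "X \<in> S" "Y \<in> S"
    and lip: "L-lipschitz_on S (ehess f)"
    and diff: "\<And>Z. Z \<in> S \<Longrightarrow> egrad f differentiable (at Z)"
  shows "norm (egrad f Y - egrad f X - ehess f X (Y - X)) \<le> L * (norm (Y - X))\<^sup>2"
proof -
  let ?T = "closed_segment X Y"
  have T: "?T \<subseteq> S" using conv X by (simp add: closed_segment_subset)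
  have "norm (egrad f Y - egrad f X - ehess f X (Y - X)) \<le> norm (Y - X) * (L * norm (Y - X))"
  proof (rule differentiable_bound_linearization[where S = ?T
        and f' = "\<lambda>Z. blinfun_apply (ehess f Z)"])
    show "X + t *\<^sub>R (Y - X) \<in> ?T" if "t \<in> {0..1}" for t
      using that by (auto simp: in_segment algebra_simps intro!: exI[of _ t])
    show "(egrad f has_derivative blinfun_apply (ehess f Z)) (at Z within ?T)" if "Z \<in> ?T" for Z
      using has_derivative_ehess[OF diff] that T has_derivative_at_withinI by blast
    show "onorm (blinfun_apply (ehess f Z) - blinfun_apply (ehess f X)) \<le> L * norm (Y - X)"
      if Z: "Z \<in> ?T" for Z
    proof -
      have "onorm (blinfun_apply (ehess f Z) - blinfun_apply (ehess f X)) = norm (ehess f Z - ehess f X)"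
        by (simp add: norm_blinfun.rep_eq minus_blinfun.rep_eq fun_diff_def)
      also have "\<dots> \<le> L * norm (Z - X)"
        using lipschitz_on_normD[OF lip] Z T X by blast
      also have "\<dots> \<le> L * norm (Y - X)"
        using segment_bound(1)[OF Z] lipschitz_on_nonneg[OF lip] by (intro mult_left_mono) auto
      finally show ?thesis .
    qed
  qed auto
  thus ?thesis by (simp add: power2_eq_square mult_ac)
qed

lemma linear_A_op: "linear (A_op f X)"
proof -
  interpret skew: bounded_linear skew by (rule bounded_linear_skew)
  show ?thesis
    by (rule linearI)
       (simp_all add: A_op_def skew.add skew.scaleR blinfun.add_right blinfun.scaleR_right
          transpose_linear_simps matmul.add_left matmul.add_right matmul.scaleR_left
          matmul.scaleR_right scaleR_add_right mult.commute)
qed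

lemma continuous_on_A_op:
  assumes "continuous_on S (ehess f)" "continuous_on S (egrad f)"
  shows "continuous_on (S \<times> UNIV) (\<lambda>(X, V). A_op f X V)"
  unfolding A_op_def case_prod_unfold
  by (intro matmul.continuous_on continuous_intros
      bounded_linear.continuous_on[OF bounded_linear_skew]
      bounded_linear.continuous_on[OF bounded_linear_transpose]
      continuous_on_compose2[OF assms(1)] continuous_on_compose2[OF assms(2)]) auto

text \<open>
  \<open>A_op f X\<close> maps the finite-dimensional tangent space into itself, so injectivity there implies
  surjectivity; the right-hand side of the equation is tangent.
\<close>
lemma tangent_step_exists_unique:
  assumes inj: "\<And>V. V \<in> tangent_layer X \<Longrightarrow> A_op f X V = 0 \<Longrightarrow> V = 0"
    and rgrad: "rgrad f X \<in> tangent_layer X"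
  shows "\<exists>!T. is_tangent_step f X T"
proof -
  let ?S = "tangent_layer X" and ?A = "A_op f X"
  have lin: "linear ?A" by (rule linear_A_op)
  have sub: "subspace ?S" by (rule subspace_tangent_layer)
  have inj_on: "inj_on ?A ?S"
  proof (rule inj_onI)
    fix U V assume UV: "U \<in> ?S" "V \<in> ?S" "?A U = ?A V"
    hence "?A (U - V) = 0" by (simp add: linear_diff[OF lin])
    thus "U = V" using inj[of "U - V"] subspace_diff[OF sub] UV by simp
  qed
  have "?A ` ?S = ?S"
  proof (rule subspace_dim_equal)
    show "subspace (?A ` ?S)" using lin sub by (rule linear_subspace_image)
    show "?A ` ?S \<subseteq> ?S" using A_op_tangent by blast
    show "dim ?S \<le> dim (?A ` ?S)"
      using dim_image_eq[OF lin, of ?S] inj_on by (simp add: span_eq_iff[THEN iffD2, OF sub])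
  qed (rule sub)
  moreover have "- rgrad f X - ?A (normal_step X) \<in> ?S"
    by (intro subspace_diff[OF sub] subspace_neg[OF sub] rgrad A_op_tangent)
  ultimately obtain T where "T \<in> ?S" "?A T = - rgrad f X - ?A (normal_step X)"
    by (metis (no_types, lifting) imageE)
  thus ?thesis
    using inj_on unfolding is_tangent_step_def inj_on_def by metis
qed

section \<open>The error of one step\<close>

text \<open>
  The derivative of \<open>X\<^sup>T X\<close> in the direction of the normal step is the Newton correction \<open>- E\<close> of the
  constraint residual \<open>E\<close>, up to a quadratic term. Both products on the left are equal because \<open>E\<close> commutes
  with \<open>X\<^sup>T X = E + I\<close>.
\<close>
lemma normal_step_gram:
  fixes X :: "real^'p^'n"
  defines "E \<equiv> transpose X ** X - mat 1"
  shows "transpose X ** normal_step X + transpose (normal_step X) ** X = - E - E ** E"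
proof -
  have E: "transpose X ** X = E + mat 1" by (simp add: E_def)
  have ET: "transpose E = E" by (simp add: E_def transpose_linear_simps matrix_transpose_mul)
  have N: "normal_step X = - ((1/2) *\<^sub>R (X ** E))" by (simp add: normal_step_def E_def)
  have left: "transpose X ** normal_step X = - ((1/2) *\<^sub>R ((E + mat 1) ** E))"
    unfolding E[symmetric]
    by (simp add: N matmul.minus_right matmul.scaleR_right matrix_mul_assoc)
  have right: "transpose (normal_step X) ** X = - ((1/2) *\<^sub>R (E ** (E + mat 1)))"
    unfolding E[symmetric]
    by (simp add: N matmul.minus_left matmul.scaleR_left transpose_linear_simps
        matrix_transpose_mul matrix_mul_assoc ET)
  show ?thesis
    unfolding left right by (simp add: matmul.add_left matmul.add_right vec_eq_iff)
qed

text \<open>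
  Expanding \<open>Y\<^sup>T Y = I\<close> at \<open>X\<close> expresses the residual \<open>E\<close> by \<open>\<Delta>\<close>, so it is of first order. In the
  first identity the linear terms cancel against those of the normal step, and the tangent step
  does not contribute.
\<close>
lemma gram_defect:
  fixes X Y :: "real^'p^'n"
  assumes Y: "Y \<in> stiefel" and T: "T \<in> tangent_layer X"
  defines "D \<equiv> X + (T + normal_step X) - Y" and "\<Delta> \<equiv> Y - X"
  defines "E \<equiv> transpose X ** X - mat 1"
  shows "transpose X ** D + transpose D ** X = transpose \<Delta> ** \<Delta> - E ** E"
    and "E = - (transpose X ** \<Delta> + transpose \<Delta> ** X + transpose \<Delta> ** \<Delta>)"
proof -
  have "mat 1 = transpose (X + \<Delta>) ** (X + \<Delta>)"
    using Y by (simp add: stiefel_def \<Delta>_def)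
  also have "\<dots> = transpose X ** X + (transpose X ** \<Delta> + transpose \<Delta> ** X + transpose \<Delta> ** \<Delta>)"
    by (simp add: matmul.add_left matmul.add_right transpose_linear_simps)
  finally show E: "E = - (transpose X ** \<Delta> + transpose \<Delta> ** X + transpose \<Delta> ** \<Delta>)"
    by (simp add: E_def)
  have "transpose X ** D + transpose D ** X
      = (transpose T ** X + transpose X ** T)
        + (transpose X ** normal_step X + transpose (normal_step X) ** X)
        - (transpose X ** \<Delta> + transpose \<Delta> ** X)"
    by (simp add: D_def \<Delta>_def matmul.add_left matmul.add_right matmul.diff_left matmul.diff_right
        transpose_linear_simps)
  also have "\<dots> = 0 + (- E - E ** E) - (- E - transpose \<Delta> ** \<Delta>)"
    using T E unfolding normal_step_gram E_def[symmetric] by (simp add: tangent_layer_def)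
  finally show "transpose X ** D + transpose D ** X = transpose \<Delta> ** \<Delta> - E ** E"
    by simp
qed

text \<open>
  The step annihilates \<open>(W(X) + W'(X)[\<Lambda>]) X\<close>, so \<open>A_op f X D\<close> is minus the linearization of \<open>W\<close> at
  \<open>X\<close>, evaluated at \<open>Y\<close> and multiplied by \<open>X\<close>. Since \<open>W(Y) = 0\<close>, this is the linearization error:
  the remainder \<open>\<rho>\<close> of the gradient, together with the product of the increments of both factors.
\<close>
lemma newton_defect:
  fixes X Y :: "real^'p^'n"
  assumes crit: "skew (egrad f Y ** transpose Y) = 0"
    and rgrad: "rgrad f X = (2 *\<^sub>R skew (egrad f X ** transpose X)) ** X"
    and T: "is_tangent_step f X T"
  defines "\<Delta> \<equiv> Y - X"
  defines "\<rho> \<equiv> egrad f Y - egrad f X - ehess f X \<Delta>"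
  shows "A_op f X (X + (T + normal_step X) - Y)
    = (2 *\<^sub>R skew (ehess f X \<Delta> ** transpose \<Delta> + \<rho> ** transpose Y)) ** X"
proof -
  interpret skew: bounded_linear skew by (rule bounded_linear_skew)
  have lin: "linear (A_op f X)" by (rule linear_A_op)
  have "A_op f X (X + (T + normal_step X) - Y) = A_op f X ((T + normal_step X) - \<Delta>)"
    by (simp add: \<Delta>_def algebra_simps)
  also have "\<dots> = - rgrad f X - A_op f X \<Delta>"
    using T by (simp add: linear_diff[OF lin] linear_add[OF lin] is_tangent_step_def)
  also have "\<dots> = - ((2 *\<^sub>R skew (egrad f X ** transpose X
      + (ehess f X \<Delta> ** transpose X + egrad f X ** transpose \<Delta>))) ** X)"
    by (simp only: rgrad A_op_def skew.add[of "egrad f X ** transpose X"] scaleR_add_right matmul.add_left)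
       simp
  also have "egrad f X ** transpose X + (ehess f X \<Delta> ** transpose X + egrad f X ** transpose \<Delta>)
      = egrad f Y ** transpose Y - (ehess f X \<Delta> ** transpose \<Delta> + \<rho> ** transpose Y)"
  proof -
    define H where "H = blinfun_apply (ehess f X) \<Delta>"
    have Y: "Y = X + \<Delta>" by (simp add: \<Delta>_def)
    have GY: "egrad f Y = egrad f X + H + \<rho>" by (simp add: \<rho>_def H_def)
    have "egrad f Y ** transpose Y = (egrad f X + H) ** transpose (X + \<Delta>) + \<rho> ** transpose Y"
      unfolding GY by (simp add: matmul.add_left Y)
    thus ?thesis
      by (simp add: H_def[symmetric] matmul.add_left matmul.add_right transpose_linear_simps)
  qed
  finally show ?thesis
    by (simp add: skew.diff crit matmul.minus_left)
qed

text \<open>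
  All terms in the two defects are quadratic in \<open>\<Delta>\<close>. The condition \<open>\<parallel>\<Delta>\<parallel> \<le> 1\<close> serves to absorb
  \<open>\<Delta>\<^sup>T \<Delta>\<close> into the linear bound \<open>\<parallel>E\<parallel> \<le> (2 R + 1) \<parallel>\<Delta>\<parallel>\<close>.
\<close>
lemma newton_step_error:
  fixes X Y :: "real^'p^'n"
  assumes Y: "Y \<in> stiefel" and crit: "skew (egrad f Y ** transpose Y) = 0"
    and rgrad: "rgrad f X = (2 *\<^sub>R skew (egrad f X ** transpose X)) ** X"
    and T: "is_tangent_step f X T"
    and taylor: "norm (egrad f Y - egrad f X - ehess f X (Y - X)) \<le> L * (norm (Y - X))\<^sup>2"
    and bounds: "norm (ehess f X) \<le> h" "norm X \<le> R" "norm Y \<le> R" "norm (Y - X) \<le> 1"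
  defines "D \<equiv> X + (T + normal_step X) - Y"
  shows "norm (A_op f X D, transpose X ** D + transpose D ** X)
    \<le> (2 * (h + L * R) * R + (1 + (2 * R + 1)\<^sup>2)) * (norm (Y - X))\<^sup>2"
proof -
  define \<Delta> where "\<Delta> = Y - X"
  define \<rho> where "\<rho> = egrad f Y - egrad f X - ehess f X \<Delta>"
  define E where "E = transpose X ** X - mat 1"
  define d where "d = norm \<Delta>"
  have R: "R \<ge> 0" using bounds(2) norm_ge_zero order_trans by blast
  have d: "0 \<le> d" "d \<le> 1" using bounds(4) by (simp_all add: d_def \<Delta>_def)
  have "norm (ehess f X \<Delta> ** transpose \<Delta>) \<le> norm (ehess f X \<Delta>) * norm (transpose \<Delta>)"
    by (rule norm_matrix_mult_le)
  also have "\<dots> \<le> (h * d) * d"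
  proof (rule mult_mono)
    have "norm (ehess f X \<Delta>) \<le> norm (ehess f X) * norm \<Delta>" by (rule norm_blinfun)
    also have "\<dots> \<le> h * d" unfolding d_def using bounds(1) by (rule mult_right_mono) simp
    finally show "norm (ehess f X \<Delta>) \<le> h * d" .
    show "0 \<le> h * d" using bounds(1) norm_ge_zero[of "ehess f X"] d by (intro mult_nonneg_nonneg) linarith+
  qed (simp_all add: norm_transpose_matrix d_def)
  finally have quad: "norm (ehess f X \<Delta> ** transpose \<Delta>) \<le> h * d\<^sup>2"
    by (simp add: power2_eq_square)
  have "norm (\<rho> ** transpose Y) \<le> norm \<rho> * norm (transpose Y)"
    by (rule norm_matrix_mult_le)
  also have "\<dots> \<le> (L * d\<^sup>2) * R"
  proof (rule mult_mono)
    show \<rho>: "norm \<rho> \<le> L * d\<^sup>2" using taylor by (simp add: \<rho>_def \<Delta>_def d_def)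
    show "0 \<le> L * d\<^sup>2" using \<rho> norm_ge_zero order_trans by blast
  qed (simp_all add: norm_transpose_matrix bounds)
  finally have rest: "norm (\<rho> ** transpose Y) \<le> L * R * d\<^sup>2" by (simp add: mult_ac)
  define Z where "Z = ehess f X \<Delta> ** transpose \<Delta> + \<rho> ** transpose Y"
  have Z: "norm Z \<le> (h + L * R) * d\<^sup>2"
    using norm_triangle_ineq[of "ehess f X \<Delta> ** transpose \<Delta>" "\<rho> ** transpose Y"] quad rest
    by (simp add: Z_def distrib_right)
  have "A_op f X D = (2 *\<^sub>R skew Z) ** X"
    unfolding D_def Z_def \<rho>_def \<Delta>_def by (rule newton_defect[OF crit rgrad T])
  hence "norm (A_op f X D) \<le> norm (2 *\<^sub>R skew Z) * norm X"
    by (simp only: norm_matrix_mult_le)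
  also have "\<dots> \<le> (2 * ((h + L * R) * d\<^sup>2)) * R"
    using norm_skew_le[of Z] Z bounds(2) R order_trans[OF norm_ge_zero Z] by (intro mult_mono) auto
  finally have fst: "norm (A_op f X D) \<le> 2 * (h + L * R) * R * d\<^sup>2" by (simp add: algebra_simps)

  have tan: "T \<in> tangent_layer X" using T by (simp add: is_tangent_step_def)
  note gram = gram_defect[OF Y tan, folded D_def \<Delta>_def E_def]
  have Xd: "norm X * d \<le> R * d" using bounds(2) d by (intro mult_right_mono)
  have XD: "norm (transpose X ** \<Delta>) \<le> R * d" "norm (transpose \<Delta> ** X) \<le> R * d"
    "norm (transpose \<Delta> ** \<Delta>) \<le> d * d"
    using norm_matrix_mult_le[of "transpose X" \<Delta>] norm_matrix_mult_le[of "transpose \<Delta>" X]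
      norm_matrix_mult_le[of "transpose \<Delta>" \<Delta>] Xd
    unfolding norm_transpose_matrix d_def[symmetric] by (simp_all add: mult.commute[of d "norm X"])
  have "norm E \<le> norm (transpose X ** \<Delta>) + norm (transpose \<Delta> ** X) + norm (transpose \<Delta> ** \<Delta>)"
    unfolding gram(2) norm_minus_cancel
    by (rule order_trans[OF norm_triangle_ineq add_right_mono[OF norm_triangle_ineq]])
  also have "\<dots> \<le> R * d + R * d + 1 * d"
    using XD mult_right_mono[OF d(2) d(1)] by linarith
  finally have E: "norm E \<le> (2 * R + 1) * d" by (simp add: algebra_simps)
  have "norm (transpose X ** D + transpose D ** X) \<le> norm (transpose \<Delta> ** \<Delta>) + norm (E ** E)"
    unfolding gram(1) by (rule norm_triangle_ineq4)
  also have "norm (E ** E) \<le> ((2 * R + 1) * d) * ((2 * R + 1) * d)"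
    using E by (intro order_trans[OF norm_matrix_mult_le] mult_mono) (auto simp: R d)
  finally have snd: "norm (transpose X ** D + transpose D ** X) \<le> (1 + (2 * R + 1)\<^sup>2) * d\<^sup>2"
    using XD(3) by (simp add: power2_eq_square algebra_simps)
  have "norm (A_op f X D, transpose X ** D + transpose D ** X)
      \<le> norm (A_op f X D) + norm (transpose X ** D + transpose D ** X)"
    by (rule norm_Pair_le)
  also have "\<dots> \<le> (2 * (h + L * R) * R + (1 + (2 * R + 1)\<^sup>2)) * d\<^sup>2"
    using fst snd by (simp add: distrib_right)
  finally show ?thesis by (simp add: d_def \<Delta>_def)
qed

section \<open>Local quadratic convergence\<close>

text \<open>
  In a ball in which \<open>C \<parallel>x - l\<parallel> \<le> 1/2\<close> every step at least halves the error, so the ball is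
  invariant and the iterates converge.
\<close>
lemma quadratic_iteration_converges:
  fixes F :: "'a::real_normed_vector \<Rightarrow> 'a"
  assumes r: "r > 0" and F: "\<And>x. x \<in> ball l r \<Longrightarrow> norm (F x - l) \<le> C * (norm (x - l))\<^sup>2"
  obtains \<delta> where "\<delta> > 0" "\<delta> \<le> r"
    "\<And>x. x 0 \<in> ball l \<delta> \<Longrightarrow> (\<And>k. x (Suc k) = F (x k)) \<Longrightarrow>
       (\<forall>k. x k \<in> ball l \<delta>) \<and> converges_quadratically x l"
proof -
  \<comment> \<open>The summand \<open>1\<close> keeps the denominator positive when \<open>C = 0\<close>.\<close>
  define \<delta> where "\<delta> = min r (1 / (2 * (\<bar>C\<bar> + 1)))"
  have half: "norm (F x - l) \<le> (1/2) * norm (x - l)" if x: "x \<in> ball l \<delta>" for x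
  proof -
    have "\<bar>C\<bar> * norm (x - l) \<le> (\<bar>C\<bar> + 1) * (1 / (2 * (\<bar>C\<bar> + 1)))"
      using x by (intro mult_mono) (auto simp: \<delta>_def dist_norm norm_minus_commute)
    also have "\<dots> = 1/2" by (simp add: field_simps)
    finally have c: "\<bar>C\<bar> * norm (x - l) \<le> 1/2" .
    have "norm (F x - l) \<le> C * (norm (x - l))\<^sup>2" using F x by (simp add: \<delta>_def)
    also have "\<dots> \<le> \<bar>C\<bar> * (norm (x - l))\<^sup>2" by (intro mult_right_mono) auto
    also have "\<dots> = (\<bar>C\<bar> * norm (x - l)) * norm (x - l)" by (simp add: power2_eq_square)
    also have "\<dots> \<le> (1/2) * norm (x - l)" using c by (intro mult_right_mono) auto
    finally show ?thesis .
  qed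
  have \<delta>: "\<delta> > 0" "\<delta> \<le> r" using r by (auto simp: \<delta>_def)
  have "(\<forall>k. x k \<in> ball l \<delta>) \<and> converges_quadratically x l"
    if x0: "x 0 \<in> ball l \<delta>" and step: "\<And>k. x (Suc k) = F (x k)" for x
  proof -
    have inv: "x k \<in> ball l \<delta> \<and> norm (x k - l) \<le> (1/2) ^ k * \<delta>" for k
    proof (induction k)
      case 0
      thus ?case using x0 by (simp add: dist_norm norm_minus_commute)
    next
      case (Suc k)
      hence "norm (x (Suc k) - l) \<le> (1/2) * norm (x k - l)" using half by (simp add: step)
      moreover have "(1/2) * norm (x k - l) \<le> (1/2) ^ Suc k * \<delta>" using Suc by simp
      moreover have "norm (x k - l) < \<delta>" using Suc by (simp add: dist_norm norm_minus_commute)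
      ultimately have "norm (x (Suc k) - l) < \<delta>" "norm (x (Suc k) - l) \<le> (1/2) ^ Suc k * \<delta>"
        using norm_ge_zero[of "x k - l"] by linarith+
      thus ?case by (simp add: dist_norm norm_minus_commute[of l])
    qed
    have "(\<lambda>k. x k - l) \<longlonglongrightarrow> 0"
    proof (rule Lim_null_comparison)
      show "\<forall>\<^sub>F k in sequentially. norm (x k - l) \<le> (1/2) ^ k * \<delta>" using inv by simp
      show "(\<lambda>k. (1/2) ^ k * \<delta>) \<longlonglongrightarrow> 0"
        by (intro tendsto_mult_left_zero LIMSEQ_realpow_zero) auto
    qed
    hence "x \<longlonglongrightarrow> l" by (simp add: LIM_zero_iff)
    moreover have "norm (x (Suc k) - l) \<le> C * (norm (x k - l))\<^sup>2" for k
      using F inv[of k] \<delta>(2) by (simp add: step)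
    ultimately show ?thesis using inv unfolding converges_quadratically_def by blast
  qed
  with \<delta> show thesis by (rule that)
qed

theorem theorem5p10:
  fixes f :: "real^'p^'n \<Rightarrow> real" and Xs :: "real^'p^'n"
    and \<epsilon> L0 L1 L2 \<delta>0 :: real
  assumes "CARD('p) \<le> CARD('n)"
    and "0 < \<epsilon>" and "\<epsilon> < 1"
    and "local_minimizer_over stiefel f Xs"
    and "twice_cont_diff_on (stiefel_nbhd \<epsilon>) f"
    and "L0-lipschitz_on (stiefel_nbhd \<epsilon>) f"
    and "L1-lipschitz_on (stiefel_nbhd \<epsilon>) (egrad f)"
    and "L2 > 0" and "\<delta>0 > 0"
    and "L2-lipschitz_on (ball Xs \<delta>0) (ehess f)"
    and "rhess_pos_def f Xs"
  shows "\<exists>\<delta>>0. \<forall>X0 \<in> ball Xs \<delta> \<inter> stiefel_nbhd \<epsilon>.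
           (\<forall>k. \<exists>!T. is_tangent_step f (iterate f X0 k) T) \<and>
           (\<forall>k. iterate f X0 k \<in> stiefel_nbhd \<epsilon>) \<and>
           converges_quadratically (iterate f X0) Xs"
proof -
  have Xs: "Xs \<in> stiefel" using assms(4) by (simp add: local_minimizer_over_def)
  hence gram: "transpose Xs ** Xs = mat 1" by (simp add: stiefel_def)
  obtain U where U: "open U" "stiefel_nbhd \<epsilon> \<subseteq> U"
    and diff: "\<And>Z. Z \<in> U \<Longrightarrow> f differentiable (at Z)" "\<And>Z. Z \<in> U \<Longrightarrow> egrad f differentiable (at Z)"
    using assms(5) unfolding twice_cont_diff_on_def by blast
  \<comment> \<open>An open set on which all smoothness assumptions are available.\<close>
  define V where "V = {Z :: real^'p^'n. norm (transpose Z ** Z - mat 1) < \<epsilon>} \<inter> ball Xs \<delta>0"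
  have "open {Z :: real^'p^'n. norm (transpose Z ** Z - mat 1) < \<epsilon>}"
    by (intro open_Collect_less continuous_intros matmul.continuous_on
        bounded_linear.continuous_on[OF bounded_linear_transpose])
  hence "open V" by (simp add: V_def open_Int)
  moreover have "Xs \<in> V" using assms(2,9) by (simp add: V_def gram)
  ultimately obtain e where e: "e > 0" "cball Xs e \<subseteq> V" using open_contains_cball by metis
  define r0 where "r0 = min e 1"
  define B where "B = cball Xs r0"
  have r0: "r0 > 0" using e by (simp add: r0_def)
  have B: "Z \<in> V" if "Z \<in> B" for Z
    using that e by (auto simp: B_def r0_def)
  hence B_nbhd: "Z \<in> stiefel_nbhd \<epsilon>" if "Z \<in> B" for Z
    using that by (fastforce simp: V_def stiefel_nbhd_def)
  have B_diff: "f differentiable (at Z)" "egrad f differentiable (at Z)" if "Z \<in> B" for Z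
    using that B_nbhd U(2) diff by blast+
  have B_lip: "L2-lipschitz_on B (ehess f)"
    using assms(10) by (rule lipschitz_on_subset) (use B in \<open>auto simp: V_def\<close>)
  have "Xs \<in> B" using r0 by (simp add: B_def)
  have crit: "skew (egrad f Xs ** transpose Xs) = 0"
    using first_order_condition assms(4) B_diff(1)[OF \<open>Xs \<in> B\<close>] by blast
  have rgrad: "rgrad f X = (2 *\<^sub>R skew (egrad f X ** transpose X)) ** X" if "X \<in> B" for X
  proof (rule rgrad_eq[OF _ B_diff(1)[OF that]])
    show "invertible (transpose X ** X)"
      using B[OF that] assms(3) by (intro invertible_near_one) (simp add: V_def)
  qed

  \<comment> \<open>The linearization at \<open>X\<close> of both equations that characterize the minimizer.\<close>
  define M where "M = (\<lambda>X D. (A_op f X D, transpose X ** D + transpose D ** X))"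
  have cont: "continuous_on (cball Xs r0 \<times> UNIV) (\<lambda>(X, D). M X D)"
  proof -
    have "continuous_on B (ehess f)" using B_lip by (rule lipschitz_on_continuous_on)
    moreover have "continuous_on B (egrad f)"
      using B_diff(2) by (intro continuous_at_imp_continuous_on) (simp add: differentiable_imp_continuous_within)
    ultimately have "continuous_on (B \<times> UNIV) (\<lambda>p. A_op f (fst p) (snd p))"
      using continuous_on_A_op[of B f] by (simp add: case_prod_unfold)
    thus ?thesis
      unfolding M_def case_prod_unfold B_def
      by (intro continuous_on_Pair continuous_on_add matmul.continuous_on continuous_intros
          bounded_linear.continuous_on[OF bounded_linear_transpose])
  qed
  have lin: "linear (M X)" for X
    unfolding M_def
    by (rule linearI)
       (simp_all add: linear_add[OF linear_A_op] linear_scale[OF linear_A_op] transpose_linear_simps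
          matmul.add_left matmul.add_right matmul.scaleR_left matmul.scaleR_right scaleR_add_right)
  have inj: "D = 0" if "M Xs D = 0" for D
  proof (rule ccontr)
    assume "D \<noteq> 0"
    have "A_op f Xs D = 0" "D \<in> tangent_layer Xs"
      using that by (simp_all add: M_def tangent_layer_def zero_prod_def add.commute)
    moreover have "rhess f Xs D = A_op f Xs D"
      using U B_nbhd[OF \<open>Xs \<in> B\<close>] by (intro rhess_eq_A_op[OF Xs U(1)] diff crit) auto
    ultimately have "0 < layer_metric Xs 0 D"
      using assms(11) \<open>D \<noteq> 0\<close> unfolding rhess_pos_def_def by metis
    thus False by (simp add: layer_metric_eq_inner)
  qed
  obtain m r where m: "m > 0" and r: "r > 0" "r \<le> r0"
    and lower: "\<And>X D. X \<in> ball Xs r \<Longrightarrow> m * norm D \<le> norm (M X D)"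
    using injective_family_lower_bound[OF r0 cont lin inj] by metis
  have ball_B: "X \<in> B" if "X \<in> ball Xs r" for X using that r by (simp add: B_def)

  have step: "\<exists>!T. is_tangent_step f X T" if X: "X \<in> ball Xs r" for X
  proof (rule tangent_step_exists_unique)
    show "V = 0" if "V \<in> tangent_layer X" "A_op f X V = 0" for V
    proof -
      have "M X V = 0" using that by (simp add: M_def tangent_layer_def zero_prod_def add.commute)
      thus ?thesis using lower[OF X, of V] m by (simp add: mult_le_0_iff)
    qed
    show "rgrad f X \<in> tangent_layer X"
      unfolding rgrad[OF ball_B[OF X]] by (rule skew_mult_tangent)
  qed

  define F where "F = (\<lambda>X. X + (tangent_step f X + normal_step X))"
  \<comment> \<open>Bounds for \<open>\<parallel>X\<parallel>\<close> and \<open>\<parallel>ehess f X\<parallel>\<close> in the unit ball around the minimizer.\<close>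
  define R where "R = norm Xs + 1"
  define h where "h = norm (ehess f Xs) + L2"
  define C where "C = (2 * (h + L2 * R) * R + (1 + (2 * R + 1)\<^sup>2)) / m"
  have quad: "norm (F X - Xs) \<le> C * (norm (X - Xs))\<^sup>2" if X: "X \<in> ball Xs r" for X
  proof -
    have XB: "X \<in> B" using ball_B X by blast
    have T: "is_tangent_step f X (tangent_step f X)"
      unfolding tangent_step_def using step[OF X] by (rule theI')
    have near: "norm (X - Xs) \<le> 1"
      using XB by (simp add: B_def r0_def dist_norm norm_minus_commute)
    have taylor: "norm (egrad f Xs - egrad f X - ehess f X (Xs - X)) \<le> L2 * (norm (Xs - X))\<^sup>2"
      by (rule egrad_taylor[OF _ XB \<open>Xs \<in> B\<close> B_lip B_diff(2)]) (simp add: B_def)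
    have "norm (ehess f X) \<le> norm (ehess f Xs) + norm (ehess f X - ehess f Xs)"
      using norm_triangle_ineq[of "ehess f Xs" "ehess f X - ehess f Xs"] by simp
    also have "norm (ehess f X - ehess f Xs) \<le> L2 * norm (X - Xs)"
      using lipschitz_on_normD[OF B_lip XB \<open>Xs \<in> B\<close>] .
    also have "\<dots> \<le> L2" using near assms(8) by (simp add: mult_left_le)
    finally have h: "norm (ehess f X) \<le> h" by (simp add: h_def)
    have nX: "norm X \<le> R" using near norm_triangle_ineq[of Xs "X - Xs"] by (simp add: R_def)
    have nXs: "norm Xs \<le> R" by (simp add: R_def)
    have near': "norm (Xs - X) \<le> 1" using near by (simp add: norm_minus_commute)
    have "m * norm (F X - Xs) \<le> norm (M X (F X - Xs))" by (rule lower[OF X])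
    also have "\<dots> \<le> (2 * (h + L2 * R) * R + (1 + (2 * R + 1)\<^sup>2)) * (norm (Xs - X))\<^sup>2"
      unfolding M_def F_def
      by (rule newton_step_error[OF Xs crit rgrad[OF XB] T taylor h nX nXs near'])
    finally show ?thesis using m by (simp add: C_def field_simps norm_minus_commute)
  qed
  obtain \<delta> where \<delta>: "\<delta> > 0" "\<delta> \<le> r"
    and conv: "\<And>x. x 0 \<in> ball Xs \<delta> \<Longrightarrow> (\<And>k. x (Suc k) = F (x k)) \<Longrightarrow>
       (\<forall>k. x k \<in> ball Xs \<delta>) \<and> converges_quadratically x Xs"
    using quadratic_iteration_converges[OF r(1) quad] by metis
  show ?thesis
  proof (intro exI[of _ \<delta>] conjI ballI)
    fix X0 assume "X0 \<in> ball Xs \<delta> \<inter> stiefel_nbhd \<epsilon>"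
    hence *: "(\<forall>k. iterate f X0 k \<in> ball Xs \<delta>) \<and> converges_quadratically (iterate f X0) Xs"
      by (intro conv) (simp_all add: F_def)
    hence "iterate f X0 k \<in> ball Xs r" for k using \<delta>(2) by (meson subset_ball subsetD)
    thus "\<forall>k. \<exists>!T. is_tangent_step f (iterate f X0 k) T" "\<forall>k. iterate f X0 k \<in> stiefel_nbhd \<epsilon>"
      using step ball_B B_nbhd by blast+
    show "converges_quadratically (iterate f X0) Xs" using * by blast
  qed (rule \<delta>(1))
qed

end
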